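(* For each $N$ let $G_N$ be an undirected graph with $N$ vertices and let $A_{G_N}$ be its adjacency matrix. Let $\pi$ be a random permutation of $\{1,\ldots,N\}$ chosen with uniform probability and define $$S_N(\pi)=\sum_{i=1}^N (A_{G_N})_{i,\pi(i)}.$$ If the variance $\mathbb{V}(S_N)$ goes to infinity as $N\to\infty$, then the distribution of $S_N$ is asymptotically normal, i.e. $\dfrac{S_N-\mathbb{E}(S_N)}{\sqrt{\mathbb{V}(S_N)}}$ converges in distribution to the standard normal distribution as $N\to\infty$.
   Context: Graphs are finite, undirected and without loops (and without multiple edges), with vertices labelled $1,\dots,N$. The adjacency matrix $A_G$ of $G=(V,E)$ is the symmetric $N\times N$ matrix with $(A_G)_{i,j}=1$ if $(i,j)\in E$ and $0$ otherwise; its diagonal entries are zero. *)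

theory Defs
  imports "HOL-Probability.Probability" "HOL-Combinatorics.Permutations"
    "Graph_Theory.Pair_Digraph"
begin

text \<open>
  A finite simple undirected graph is a \<open>pair_graph\<close>: a finite, loop-free, symmetric set of
  ordered pairs on a finite vertex set. An undirected edge is thus represented by both of
  its orientations.
\<close>

definition adjacency_matrix :: "'v pair_pre_digraph \<Rightarrow> 'v \<Rightarrow> 'v \<Rightarrow> real" where
  "adjacency_matrix G i j = (if (i, j) \<in> parcs G then 1 else 0)"

definition random_permutation :: "nat \<Rightarrow> (nat \<Rightarrow> nat) pmf" where
  "random_permutation N = pmf_of_set {\<pi>. \<pi> permutes {1..N}}"

definition perm_sum :: "(nat \<Rightarrow> nat \<Rightarrow> real) \<Rightarrow> nat \<Rightarrow> (nat \<Rightarrow> nat) \<Rightarrow> real" where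
  "perm_sum A N \<pi> = (\<Sum>i=1..N. A i (\<pi> i))"

end

theory Submission
  imports Defs
begin

text \<open>
  Hoeffding's combinatorial central limit theorem for arrays with uniformly bounded entries,
  of which the statistic of an adjacency matrix (entries \<open>0\<close> and \<open>1\<close>) is an instance.

  Subtracting row means and column means and adding back the overall mean changes the statistic
  of a permutation only by its expectation. So let \<open>a\<close> be a matrix with vanishing row and column
  sums, \<open>W \<pi> = (\<Sum>i. a i (\<pi> i))\<close> and \<open>V\<close> the variance of \<open>W\<close>. Everything rests on one exchange
  argument (\<open>perm_sum_exchange\<close>). Since \<open>(\<Sum>j. a i (\<pi> j))\<close> is a row sum, hence zero, and since
  composing a uniform \<open>\<pi>\<close> with the transposition of \<open>i\<close> and \<open>j\<close> leaves it uniform,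
  \[ N \, E[W h(\pi)] = \sum_{i,j} E[a_{i\pi(i)} (h(\pi) - h(\pi \circ (i\,j)))] \]
  for every function \<open>h\<close> of the permutation. This is used for three choices of \<open>h\<close>.

  For \<open>h = W\<close> it shows that \<open>D = Y + W\<^sup>2 / N\<close>, with \<open>Y \<pi> = (\<Sum>i. (a i (\<pi> i))\<^sup>2)\<close>, has expectation
  \<open>V\<close>. For the matrix of squares in place of \<open>a\<close> and \<open>h = Y\<close> it bounds the variance of \<open>Y\<close> by a
  constant times \<open>V + V\<^sup>2 / N\<close>; hence \<open>D / V\<close> tends to \<open>1\<close> in mean when \<open>V\<close> and \<open>N\<close> tend to infinity.
  For \<open>h = exp (\<i> s W)\<close>, a second-order Taylor expansion of the difference turns the identity into
  Stein's equation in Fourier form: \<open>\<psi> s = E (exp (\<i> s W))\<close> satisfies \<open>\<psi>' s = - V s \<psi> s\<close> up to an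
  error controlled by the mean distance of \<open>D\<close> from \<open>V\<close> and by the bound on the entries
  (\<open>stein_iexp\<close>). Comparison with the exact solution \<open>exp (- V s\<^sup>2 / 2)\<close> (\<open>gaussian_ode_bound\<close>),
  rescaling by the standard deviation and Levy's continuity theorem finish the proof.
\<close>

section \<open>Expectation over uniform permutations\<close>

abbreviation perm_exp ::
    "nat \<Rightarrow> ((nat \<Rightarrow> nat) \<Rightarrow> 'b::{banach, second_countable_topology}) \<Rightarrow> 'b" where
  "perm_exp N f \<equiv> measure_pmf.expectation (random_permutation N) f"

lemma set_random_permutation: "set_pmf (random_permutation N) = {\<pi>. \<pi> permutes {1..N}}"
proof -
  have "{\<pi>. \<pi> permutes {1..N}} \<noteq> {}"
    using permutes_id by blast
  then show ?thesis
    unfolding random_permutation_def by (intro set_pmf_of_set) (simp_all add: finite_permutations)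
qed

lemma integrable_random_permutation [simp]:
  fixes f :: "(nat \<Rightarrow> nat) \<Rightarrow> 'b::{banach, second_countable_topology}"
  shows "integrable (measure_pmf (random_permutation N)) f"
  by (rule integrable_measure_pmf_finite) (simp add: set_random_permutation finite_permutations)

lemma AE_random_permutationI:
  "(\<And>\<pi>. \<pi> permutes {1..N} \<Longrightarrow> P \<pi>) \<Longrightarrow> AE \<pi> in measure_pmf (random_permutation N). P \<pi>"
  by (simp add: AE_measure_pmf_iff set_random_permutation)

lemma perm_exp_cong:
  "(\<And>\<pi>. \<pi> permutes {1..N} \<Longrightarrow> f \<pi> = g \<pi>) \<Longrightarrow> perm_exp N f = perm_exp N g"
  by (intro integral_cong_AE AE_random_permutationI) auto

lemma perm_exp_mono:
  fixes f g :: "(nat \<Rightarrow> nat) \<Rightarrow> real"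
  shows "(\<And>\<pi>. \<pi> permutes {1..N} \<Longrightarrow> f \<pi> \<le> g \<pi>) \<Longrightarrow> perm_exp N f \<le> perm_exp N g"
  by (intro integral_mono_AE AE_random_permutationI) auto

lemma perm_exp_compose_right:
  fixes f :: "(nat \<Rightarrow> nat) \<Rightarrow> 'b::{banach, second_countable_topology}"
  assumes "\<tau> permutes {1..N}"
  shows "perm_exp N (\<lambda>\<pi>. f (\<pi> \<circ> \<tau>)) = perm_exp N f"
proof -
  let ?P = "{\<pi>. \<pi> permutes {1..N}}"
  have "bij_betw (\<lambda>\<pi>. \<pi> \<circ> \<tau>) ?P ?P"
    by (rule bij_betw_byWitness[where f' = "\<lambda>\<pi>. \<pi> \<circ> inv \<tau>"])
      (auto simp: o_assoc[symmetric] permutes_inv_o[OF assms] simp del: One_nat_def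
        intro: permutes_compose permutes_inv assms)
  moreover have "?P \<noteq> {}"
    using permutes_id by blast
  ultimately have "map_pmf (\<lambda>\<pi>. \<pi> \<circ> \<tau>) (random_permutation N) = random_permutation N"
    unfolding random_permutation_def
    by (intro map_pmf_of_set_bij_betw) (auto simp: finite_permutations)
  then have "perm_exp N f = measure_pmf.expectation (map_pmf (\<lambda>\<pi>. \<pi> \<circ> \<tau>) (random_permutation N)) f"
    by simp
  then show ?thesis
    by simp
qed

section \<open>The exchange identity\<close>

text \<open>
  Substituting \<open>\<pi> \<circ> (i j)\<close> for \<open>\<pi>\<close> turns \<open>a i (\<pi> i) h (\<pi> \<circ> (i j))\<close> into \<open>a i (\<pi> j) h \<pi>\<close>, and for a
  fixed permutation the sum of \<open>a i (\<pi> j)\<close> over \<open>j\<close> is a row sum, which no longer depends on \<open>\<pi>\<close>.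
\<close>

lemma perm_exp_exchange:
  fixes a :: "nat \<Rightarrow> nat \<Rightarrow> real"
    and h :: "(nat \<Rightarrow> nat) \<Rightarrow> 'b::{banach, second_countable_topology}"
  shows "perm_exp N (\<lambda>\<pi>. \<Sum>i=1..N. \<Sum>j=1..N. a i (\<pi> i) *\<^sub>R h (\<pi> \<circ> Transposition.transpose i j))
    = (\<Sum>i=1..N. \<Sum>j=1..N. a i j) *\<^sub>R perm_exp N h"
proof -
  have "perm_exp N (\<lambda>\<pi>. a i (\<pi> i) *\<^sub>R h (\<pi> \<circ> Transposition.transpose i j)) = perm_exp N (\<lambda>\<pi>. a i (\<pi> j) *\<^sub>R h \<pi>)"
    if "i \<in> {1..N}" "j \<in> {1..N}" for i j
    using perm_exp_compose_right[OF permutes_swap_id[OF that], of "\<lambda>\<pi>. a i (\<pi> j) *\<^sub>R h \<pi>"] by simp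
  then have "perm_exp N (\<lambda>\<pi>. \<Sum>i=1..N. \<Sum>j=1..N. a i (\<pi> i) *\<^sub>R h (\<pi> \<circ> Transposition.transpose i j))
      = perm_exp N (\<lambda>\<pi>. \<Sum>i=1..N. \<Sum>j=1..N. a i (\<pi> j) *\<^sub>R h \<pi>)"
    by (simp add: Bochner_Integration.integral_sum)
  also have "\<dots> = perm_exp N (\<lambda>\<pi>. (\<Sum>i=1..N. \<Sum>j=1..N. a i j) *\<^sub>R h \<pi>)"
  proof (rule perm_exp_cong)
    fix \<pi> assume \<pi>: "\<pi> permutes {1..N}"
    have "(\<Sum>j=1..N. a i (\<pi> j)) = (\<Sum>j=1..N. a i j)" for i
      using sum.permute[OF \<pi>, of "a i"] by (simp add: o_def)
    then show "(\<Sum>i=1..N. \<Sum>j=1..N. a i (\<pi> j) *\<^sub>R h \<pi>) = (\<Sum>i=1..N. \<Sum>j=1..N. a i j) *\<^sub>R h \<pi>"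
      by (simp flip: scaleR_sum_left)
  qed
  finally show ?thesis
    by simp
qed

lemma perm_exp_perm_sum: "real N * perm_exp N (perm_sum a N) = (\<Sum>i=1..N. \<Sum>j=1..N. a i j)"
  using perm_exp_exchange[of N a "\<lambda>_. 1::real"]
  by (simp add: perm_sum_def[abs_def] flip: sum_distrib_left)

text \<open>
  A covariance formula: the covariance of the permutation statistic with an arbitrary function
  \<open>h\<close> is expressed by the increments of \<open>h\<close> under transpositions. The value type of \<open>h\<close> is kept
  general because both real functions (for second moments) and complex exponentials (for the
  characteristic function) are inserted below.
\<close>

lemma perm_sum_exchange:
  fixes a :: "nat \<Rightarrow> nat \<Rightarrow> real"
    and h :: "(nat \<Rightarrow> nat) \<Rightarrow> 'b::{banach, second_countable_topology}"
  shows "real N *\<^sub>R perm_exp N (\<lambda>\<pi>. perm_sum a N \<pi> *\<^sub>R h \<pi>)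
    = (real N * perm_exp N (perm_sum a N)) *\<^sub>R perm_exp N h
      + perm_exp N (\<lambda>\<pi>. \<Sum>i=1..N. \<Sum>j=1..N. a i (\<pi> i) *\<^sub>R (h \<pi> - h (\<pi> \<circ> Transposition.transpose i j)))"
proof -
  have "perm_exp N (\<lambda>\<pi>. \<Sum>i=1..N. \<Sum>j=1..N. a i (\<pi> i) *\<^sub>R (h \<pi> - h (\<pi> \<circ> Transposition.transpose i j)))
    = perm_exp N (\<lambda>\<pi>. real N *\<^sub>R (perm_sum a N \<pi> *\<^sub>R h \<pi>))
      - perm_exp N (\<lambda>\<pi>. \<Sum>i=1..N. \<Sum>j=1..N. a i (\<pi> i) *\<^sub>R h (\<pi> \<circ> Transposition.transpose i j))"
    by (subst Bochner_Integration.integral_diff[symmetric])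
      (simp_all add: perm_sum_def scaleR_diff_right sum_subtractf scaleR_sum_left scaleR_sum_right
        sum_constant_scaleR)
  also have "perm_exp N (\<lambda>\<pi>. real N *\<^sub>R (perm_sum a N \<pi> *\<^sub>R h \<pi>))
    = real N *\<^sub>R perm_exp N (\<lambda>\<pi>. perm_sum a N \<pi> *\<^sub>R h \<pi>)"
    by (rule integral_scaleR_right)
  finally show ?thesis
    by (simp only: perm_exp_exchange perm_exp_perm_sum add_diff_eq add_diff_cancel_left')
qed

definition transposition_drop :: "(nat \<Rightarrow> nat \<Rightarrow> real) \<Rightarrow> (nat \<Rightarrow> nat) \<Rightarrow> nat \<Rightarrow> nat \<Rightarrow> real" where
  "transposition_drop a \<pi> i j = a i (\<pi> i) + a j (\<pi> j) - a i (\<pi> j) - a j (\<pi> i)"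

lemma perm_sum_transpose:
  assumes "i \<in> {1..N}" "j \<in> {1..N}"
  shows "perm_sum a N (\<pi> \<circ> Transposition.transpose i j) = perm_sum a N \<pi> - transposition_drop a \<pi> i j"
proof (cases "i = j")
  case True
  then show ?thesis by (simp add: transposition_drop_def)
next
  case False
  let ?R = "{1..N} - {i} - {j}"
  have *: "(\<Sum>k=1..N. f k) = f i + (f j + (\<Sum>k\<in>?R. f k))" for f :: "nat \<Rightarrow> real"
    using assms False sum.remove[of "{1..N}" i f] sum.remove[of "{1..N} - {i}" j f] by simp
  have "(\<Sum>k\<in>?R. a k ((\<pi> \<circ> Transposition.transpose i j) k)) = (\<Sum>k\<in>?R. a k (\<pi> k))"
    by (intro sum.cong) (auto simp: transpose_apply_other)
  then show ?thesis
    unfolding perm_sum_def * transposition_drop_def by simp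
qed

lemma perm_sum_exchange_perm_sum:
  "real N * perm_exp N (\<lambda>\<pi>. (perm_sum a N \<pi>)\<^sup>2)
    = real N * (perm_exp N (perm_sum a N))\<^sup>2
      + perm_exp N (\<lambda>\<pi>. \<Sum>i=1..N. \<Sum>j=1..N. a i (\<pi> i) * transposition_drop a \<pi> i j)"
proof -
  have "perm_exp N (\<lambda>\<pi>. \<Sum>i=1..N. \<Sum>j=1..N. a i (\<pi> i) *
      (perm_sum a N \<pi> - perm_sum a N (\<pi> \<circ> Transposition.transpose i j)))
    = perm_exp N (\<lambda>\<pi>. \<Sum>i=1..N. \<Sum>j=1..N. a i (\<pi> i) * transposition_drop a \<pi> i j)"
    by (intro perm_exp_cong sum.cong) (auto simp: perm_sum_transpose)
  then show ?thesis
    using perm_sum_exchange[of N a "perm_sum a N"]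
    by (simp only: real_scaleR_def power2_eq_square mult.assoc)
qed

lemma perm_variance_eq:
  fixes X :: "(nat \<Rightarrow> nat) \<Rightarrow> real"
  shows "measure_pmf.variance (random_permutation N) X
    = perm_exp N (\<lambda>\<pi>. (X \<pi>)\<^sup>2) - (perm_exp N X)\<^sup>2"
  by (rule measure_pmf.variance_eq) simp_all

text \<open>
  The variance of \<open>\<bar>X\<bar>\<close> is nonnegative.
\<close>

lemma perm_exp_abs_le_sqrt:
  fixes X :: "(nat \<Rightarrow> nat) \<Rightarrow> real"
  shows "perm_exp N (\<lambda>\<pi>. \<bar>X \<pi>\<bar>) \<le> sqrt (perm_exp N (\<lambda>\<pi>. (X \<pi>)\<^sup>2))"
  using measure_pmf.variance_positive[of "random_permutation N" "\<lambda>\<pi>. \<bar>X \<pi>\<bar>"]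
  by (intro real_le_rsqrt) (simp add: perm_variance_eq)

text \<open>
  For nonnegative entries the negative terms of \<open>transposition_drop\<close> can be discarded, which leaves
  \<open>b i (\<pi> i) * (K + b j (\<pi> j))\<close> and hence, after summation, \<open>N K Y + Y\<^sup>2\<close>. The second moment of \<open>Y\<close>
  thus occurs on both sides of the covariance formula; moving it to the left produces the factor
  \<open>N - 1\<close>.
\<close>

lemma variance_perm_sum_nonneg_le:
  assumes b0: "\<And>i j. i \<in> {1..N} \<Longrightarrow> j \<in> {1..N} \<Longrightarrow> 0 \<le> b i j"
    and bK: "\<And>i j. i \<in> {1..N} \<Longrightarrow> j \<in> {1..N} \<Longrightarrow> b i j \<le> K"
  shows "(real N - 1) * measure_pmf.variance (random_permutation N) (perm_sum b N)
    \<le> real N * K * perm_exp N (perm_sum b N) + (perm_exp N (perm_sum b N))\<^sup>2"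
proof -
  let ?Y = "perm_sum b N"
  have "perm_exp N (\<lambda>\<pi>. \<Sum>i=1..N. \<Sum>j=1..N. b i (\<pi> i) * transposition_drop b \<pi> i j)
    \<le> perm_exp N (\<lambda>\<pi>. real N * K * ?Y \<pi> + (?Y \<pi>)\<^sup>2)"
  proof (rule perm_exp_mono)
    fix \<pi> assume "\<pi> permutes {1..N}"
    then have \<pi>: "\<pi> i \<in> {1..N}" if "i \<in> {1..N}" for i
      using that by (simp only: permutes_in_image)
    have "(\<Sum>i=1..N. \<Sum>j=1..N. b i (\<pi> i) * transposition_drop b \<pi> i j)
      \<le> (\<Sum>i=1..N. \<Sum>j=1..N. b i (\<pi> i) * (K + b j (\<pi> j)))"
    proof (intro sum_mono mult_left_mono)
      fix i j assume ij: "i \<in> {1..N}" "j \<in> {1..N}"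
      show "transposition_drop b \<pi> i j \<le> K + b j (\<pi> j)"
        using b0[OF ij(1) \<pi>[OF ij(2)]] b0[OF ij(2) \<pi>[OF ij(1)]] bK[OF ij(1) \<pi>[OF ij(1)]]
        by (simp add: transposition_drop_def)
    qed (use b0 \<pi> in blast)
    also have "\<dots> = (\<Sum>i=1..N. b i (\<pi> i) * (real N * K + ?Y \<pi>))"
      by (simp add: perm_sum_def sum.distrib flip: sum_distrib_left)
    also have "\<dots> = ?Y \<pi> * (real N * K + ?Y \<pi>)"
      unfolding perm_sum_def by (rule sum_distrib_right[symmetric])
    also have "\<dots> = real N * K * ?Y \<pi> + (?Y \<pi>)\<^sup>2"
      by (simp add: power2_eq_square algebra_simps)
    finally show "(\<Sum>i=1..N. \<Sum>j=1..N. b i (\<pi> i) * transposition_drop b \<pi> i j)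
      \<le> real N * K * ?Y \<pi> + (?Y \<pi>)\<^sup>2" .
  qed
  also have "\<dots> = real N * K * perm_exp N ?Y + perm_exp N (\<lambda>\<pi>. (?Y \<pi>)\<^sup>2)"
    by simp
  finally show ?thesis
    using perm_sum_exchange_perm_sum[of N b] by (simp add: perm_variance_eq algebra_simps)
qed

section \<open>Approximate solutions of the Gaussian differential equation\<close>

text \<open>
  The integrating factor \<open>exp (v u\<^sup>2 / 2)\<close> removes the linear term, so the mean value inequality
  bounds the distance of \<open>exp (v s\<^sup>2 / 2) * \<psi> s\<close> from its value \<open>1\<close> at \<open>0\<close>. On the interval
  \<open>\<bar>u\<bar> \<le> \<bar>s\<bar>\<close> the integrating factor is largest at the endpoints, and its value there cancels when
  the result is divided by it; hence no exponential remains in the bound.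
\<close>

lemma gaussian_ode_bound:
  fixes \<psi> :: "real \<Rightarrow> complex"
  assumes deriv: "\<And>s. (\<psi> has_vector_derivative \<psi>' s) (at s)"
    and init: "\<psi> 0 = 1"
    and bound: "\<And>s. cmod (\<psi>' s + of_real (v * s) * \<psi> s) \<le> \<alpha> * \<bar>s\<bar> + \<beta> * s\<^sup>2"
    and "v \<ge> 0" "\<alpha> \<ge> 0" "\<beta> \<ge> 0"
  shows "cmod (\<psi> s - of_real (exp (- (v * s\<^sup>2) / 2))) \<le> \<alpha> * s\<^sup>2 + \<beta> * \<bar>s\<bar> ^ 3"
proof -
  define E where "E u = exp (v * u\<^sup>2 / 2)" for u
  define g where "g u = E u *\<^sub>R \<psi> u" for u
  have dE: "(E has_real_derivative v * u * E u) (at u)" for u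
    unfolding E_def by (auto intro!: derivative_eq_intros)
  have dg: "(g has_vector_derivative E u *\<^sub>R (\<psi>' u + of_real (v * u) * \<psi> u)) (at u)" for u
    unfolding g_def
    by (rule has_vector_derivative_eq_rhs[OF has_vector_derivative_scaleR[OF dE deriv]])
      (simp add: scaleR_conv_of_real algebra_simps)
  define B where "B = E s * (\<alpha> * \<bar>s\<bar> + \<beta> * s\<^sup>2)"
  define S where "S = {-\<bar>s\<bar>..\<bar>s\<bar>}"
  have "norm (g s - g 0) \<le> B * norm (s - 0)"
  proof (rule differentiable_bound)
    show "convex S" "s \<in> S" "0 \<in> S" by (auto simp: S_def)
    show "(g has_derivative (\<lambda>x. x *\<^sub>R (E u *\<^sub>R (\<psi>' u + of_real (v * u) * \<psi> u)))) (at u within S)" for u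
      using dg has_derivative_at_withinI unfolding has_vector_derivative_def by blast
    fix u assume "u \<in> S"
    then have u: "\<bar>u\<bar> \<le> \<bar>s\<bar>" by (auto simp: S_def)
    then have u2: "u\<^sup>2 \<le> s\<^sup>2" by (simp add: abs_le_square_iff)
    have "E u \<le> E s"
      unfolding E_def using mult_left_mono[OF u2 \<open>v \<ge> 0\<close>] by simp
    moreover have "cmod (\<psi>' u + of_real (v * u) * \<psi> u) \<le> \<alpha> * \<bar>s\<bar> + \<beta> * s\<^sup>2"
      using bound[of u] mult_left_mono[OF u \<open>\<alpha> \<ge> 0\<close>] mult_left_mono[OF u2 \<open>\<beta> \<ge> 0\<close>] by linarith
    ultimately have "norm (E u *\<^sub>R (\<psi>' u + of_real (v * u) * \<psi> u)) \<le> B"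
      unfolding B_def norm_scaleR by (intro mult_mono) (auto simp: E_def)
    then show "onorm (\<lambda>x. x *\<^sub>R (E u *\<^sub>R (\<psi>' u + of_real (v * u) * \<psi> u))) \<le> B"
      by (intro onorm_le) (metis mult.commute mult_right_mono norm_ge_zero norm_scaleR real_norm_def)
  qed
  then have "norm (g s - 1) \<le> E s * (\<alpha> * \<bar>s\<bar> + \<beta> * s\<^sup>2) * \<bar>s\<bar>"
    by (simp add: B_def g_def E_def init)
  moreover have "norm (g s - 1) = E s * cmod (\<psi> s - of_real (exp (- (v * s\<^sup>2) / 2)))"
  proof -
    have "E s * exp (- (v * s\<^sup>2) / 2) = 1"
      unfolding E_def by (simp flip: exp_add)
    then have "complex_of_real (E s) * of_real (exp (- (v * s\<^sup>2) / 2)) = 1"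
      by (simp only: of_real_mult[symmetric] of_real_1)
    then have "g s - 1 = E s *\<^sub>R (\<psi> s - of_real (exp (- (v * s\<^sup>2) / 2)))"
      by (simp only: g_def scaleR_conv_of_real right_diff_distrib)
    then show ?thesis by (simp add: E_def)
  qed
  ultimately have "cmod (\<psi> s - of_real (exp (- (v * s\<^sup>2) / 2))) \<le> (\<alpha> * \<bar>s\<bar> + \<beta> * s\<^sup>2) * \<bar>s\<bar>"
    by (simp add: E_def mult.assoc)
  also have "\<dots> = \<alpha> * s\<^sup>2 + \<beta> * \<bar>s\<bar> ^ 3"
    by (simp add: power2_eq_square power3_eq_cube algebra_simps)
  finally show ?thesis .
qed

section \<open>Characteristic functions and first-order increments\<close>

lemma perm_exp_iexp_has_vector_derivative:
  fixes X :: "(nat \<Rightarrow> nat) \<Rightarrow> real"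
  shows "((\<lambda>s. perm_exp N (\<lambda>\<pi>. iexp (s * X \<pi>))) has_vector_derivative
    perm_exp N (\<lambda>\<pi>. \<i> * (X \<pi> *\<^sub>R iexp (s * X \<pi>)))) (at s)"
proof -
  let ?P = "{\<pi>. \<pi> permutes {1..N}}"
  have sum: "perm_exp N f = (\<Sum>\<pi>\<in>?P. pmf (random_permutation N) \<pi> *\<^sub>R f \<pi>)" for f :: "_ \<Rightarrow> complex"
    by (rule integral_measure_pmf) (auto simp: finite_permutations set_random_permutation)
  have "((\<lambda>s. iexp (s * x)) has_vector_derivative \<i> * (x *\<^sub>R iexp (s * x))) (at s)" for x
  proof -
    have "((\<lambda>s. exp ((\<i> * of_real x) * of_real s)) has_vector_derivative
        (\<i> * of_real x) * exp ((\<i> * of_real x) * of_real s)) (at s)"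
      by (rule has_vector_derivative_real_field) (auto intro!: derivative_eq_intros)
    then show ?thesis
      by (simp add: scaleR_conv_of_real mult_ac)
  qed
  then show ?thesis
    unfolding sum
    by (intro has_vector_derivative_sum
      bounded_linear.has_vector_derivative[OF bounded_linear_scaleR_right])
qed

text \<open>
  After division by \<open>iexp x\<close>, of modulus one, this is the Taylor expansion of \<open>iexp\<close> at \<open>0\<close> up to
  first order, evaluated at \<open>- d\<close>.
\<close>

lemma iexp_diff_bound:
  "cmod (iexp x - iexp (x - d) - (\<i> * of_real d) * iexp x) \<le> d\<^sup>2 / 2"
proof -
  have "iexp (x - d) = iexp x * iexp (- d)"
    by (simp add: ring_distribs flip: exp_add)
  then have "iexp x - iexp (x - d) - (\<i> * of_real d) * iexp x
      = - (iexp x * (iexp (- d) - (1 + \<i> * of_real (- d))))"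
    by (simp add: algebra_simps)
  also have "cmod \<dots> = cmod (iexp (- d) - (1 + \<i> * of_real (- d)))"
    by (simp add: norm_mult)
  also have "\<dots> \<le> d\<^sup>2 / 2"
    using iexp_approx1[of "- d" 1] by (simp add: numeral_2_eq_2)
  finally show ?thesis .
qed

section \<open>Matrices with vanishing row and column sums\<close>

locale centred_matrix =
  fixes N :: nat and a :: "nat \<Rightarrow> nat \<Rightarrow> real" and C :: real
  assumes row_sum: "\<And>i. i \<in> {1..N} \<Longrightarrow> (\<Sum>j=1..N. a i j) = 0"
    and col_sum: "\<And>j. j \<in> {1..N} \<Longrightarrow> (\<Sum>i=1..N. a i j) = 0"
    and entry_bound: "\<And>i j. i \<in> {1..N} \<Longrightarrow> j \<in> {1..N} \<Longrightarrow> \<bar>a i j\<bar> \<le> C"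
    and size: "N \<ge> 2"
begin

abbreviation W :: "(nat \<Rightarrow> nat) \<Rightarrow> real" where
  "W \<equiv> perm_sum a N"

abbreviation Y :: "(nat \<Rightarrow> nat) \<Rightarrow> real" where
  "Y \<equiv> perm_sum (\<lambda>i j. (a i j)\<^sup>2) N"

definition V :: real where
  "V = perm_exp N (\<lambda>\<pi>. (W \<pi>)\<^sup>2)"

text \<open>
  The random variable that replaces the variance in Stein's equation for \<open>W\<close>: up to the factor \<open>N\<close>
  it is the sum of the first-order increments \<open>a i (\<pi> i) * transposition_drop a \<pi> i j\<close>.
\<close>

definition D :: "(nat \<Rightarrow> nat) \<Rightarrow> real" where
  "D \<pi> = Y \<pi> + (W \<pi>)\<^sup>2 / N"

lemma C_nonneg: "C \<ge> 0"
  using entry_bound[of 1 1] size by simp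

lemma V_nonneg: "V \<ge> 0"
  unfolding V_def by (rule Bochner_Integration.integral_nonneg) simp

lemma Y_nonneg: "Y \<pi> \<ge> 0"
  unfolding perm_sum_def by (rule sum_nonneg) simp

lemma perm_exp_W: "perm_exp N W = 0"
proof -
  have "real N * perm_exp N W = 0"
    unfolding perm_exp_perm_sum by (intro sum.neutral ballI row_sum)
  then show ?thesis
    using size by simp
qed

text \<open>
  Of the four terms of \<open>transposition_drop\<close>, the two mixed ones sum over \<open>j\<close> to a row sum and to a
  column sum of \<open>a\<close> and therefore vanish. This is where both centring conditions enter.
\<close>

lemma weighted_transposition_drop_sum:
  assumes \<pi>: "\<pi> permutes {1..N}"
  shows "(\<Sum>i=1..N. \<Sum>j=1..N. a i (\<pi> i) * transposition_drop a \<pi> i j) = real N * D \<pi>"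
proof -
  have "(\<Sum>j=1..N. transposition_drop a \<pi> i j) = real N * a i (\<pi> i) + W \<pi>" if i: "i \<in> {1..N}" for i
  proof -
    have "(\<Sum>j=1..N. a i (\<pi> j)) = (\<Sum>j=1..N. a i j)"
      using sum.permute[OF \<pi>, of "a i"] by (simp add: o_def)
    moreover have "(\<Sum>j=1..N. a j (\<pi> i)) = 0"
      using i \<pi> by (intro col_sum) (simp only: permutes_in_image)
    ultimately show ?thesis
      using row_sum[OF i] unfolding transposition_drop_def perm_sum_def
      by (simp add: sum.distrib sum_subtractf)
  qed
  then have "(\<Sum>i=1..N. \<Sum>j=1..N. a i (\<pi> i) * transposition_drop a \<pi> i j)
      = (\<Sum>i=1..N. a i (\<pi> i) * (real N * a i (\<pi> i) + W \<pi>))"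
    unfolding sum_distrib_left[symmetric] by (intro sum.cong refl) simp
  also have "\<dots> = (\<Sum>i=1..N. real N * (a i (\<pi> i))\<^sup>2 + a i (\<pi> i) * W \<pi>)"
    by (intro sum.cong refl) (simp add: power2_eq_square algebra_simps)
  also have "\<dots> = real N * Y \<pi> + W \<pi> * W \<pi>"
    unfolding sum.distrib perm_sum_def sum_distrib_left[symmetric] sum_distrib_right[symmetric] ..
  also have "\<dots> = real N * D \<pi>"
    using size by (simp add: D_def field_simps power2_eq_square)
  finally show ?thesis .
qed

text \<open>
  The covariance formula for \<open>h = W\<close>.
\<close>

lemma perm_exp_D: "perm_exp N D = V"
proof -
  have "real N * V = perm_exp N (\<lambda>\<pi>. \<Sum>i=1..N. \<Sum>j=1..N. a i (\<pi> i) * transposition_drop a \<pi> i j)"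
    unfolding V_def perm_sum_exchange_perm_sum perm_exp_W by simp
  also have "\<dots> = perm_exp N (\<lambda>\<pi>. real N * D \<pi>)"
    by (intro perm_exp_cong weighted_transposition_drop_sum)
  also have "\<dots> = real N * perm_exp N D"
    by simp
  finally show ?thesis
    using size by simp
qed

lemma perm_exp_Y: "perm_exp N Y = V - V / N"
proof -
  have "perm_exp N D = perm_exp N Y + V / N"
    unfolding D_def V_def by simp
  then show ?thesis
    by (simp add: perm_exp_D)
qed

lemma perm_exp_Y_le: "perm_exp N Y \<le> V"
  using V_nonneg by (simp add: perm_exp_Y)

lemma perm_exp_Y_nonneg: "0 \<le> perm_exp N Y"
  by (rule Bochner_Integration.integral_nonneg) (rule Y_nonneg)

text \<open>
  The square of a sum of four terms is at most four times the sum of their squares. Summed over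
  \<open>i\<close> and \<open>j\<close>, the two diagonal squares each give \<open>N Y\<close>, whereas the two mixed ones each run through
  all entries of the matrix, whose sum of squares is \<open>N\<close> times the expectation of \<open>Y\<close>.
\<close>

lemma transposition_drop_sq_sum_le:
  assumes \<pi>: "\<pi> permutes {1..N}"
  shows "(\<Sum>i=1..N. \<Sum>j=1..N. (transposition_drop a \<pi> i j)\<^sup>2)
    \<le> 8 * (real N * Y \<pi> + real N * perm_exp N Y)"
proof -
  \<comment> \<open>Cauchy's inequality, with the deficit written as the sum of the squares of the pairwise
    differences of \<open>x\<close>, \<open>y\<close>, \<open>- z\<close>, \<open>- w\<close>\<close>
  have sq: "(x + y - z - w)\<^sup>2 \<le> 4 * (x\<^sup>2 + y\<^sup>2 + z\<^sup>2 + w\<^sup>2)" for x y z w :: real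
  proof -
    have "4 * (x\<^sup>2 + y\<^sup>2 + z\<^sup>2 + w\<^sup>2) - (x + y - z - w)\<^sup>2
      = (x - y)\<^sup>2 + (x + z)\<^sup>2 + (x + w)\<^sup>2 + (y + z)\<^sup>2 + (y + w)\<^sup>2 + (z - w)\<^sup>2"
      by (simp add: power2_eq_square algebra_simps)
    then show ?thesis
      by (smt (verit) zero_le_power2)
  qed
  have Q: "real N * perm_exp N Y = (\<Sum>i=1..N. \<Sum>j=1..N. (a i j)\<^sup>2)"
    by (rule perm_exp_perm_sum)
  have Q1: "(\<Sum>i=1..N. \<Sum>j=1..N. (a i (\<pi> j))\<^sup>2) = real N * perm_exp N Y"
    unfolding Q
  proof (rule sum.cong[OF refl])
    show "(\<Sum>j=1..N. (a i (\<pi> j))\<^sup>2) = (\<Sum>j=1..N. (a i j)\<^sup>2)" for i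
      using sum.permute[OF \<pi>, of "\<lambda>j. (a i j)\<^sup>2"] by (simp add: o_def)
  qed
  have Q2: "(\<Sum>i=1..N. \<Sum>j=1..N. (a j (\<pi> i))\<^sup>2) = real N * perm_exp N Y"
    by (subst sum.swap) (rule Q1)
  have "(\<Sum>i=1..N. \<Sum>j=1..N. (transposition_drop a \<pi> i j)\<^sup>2)
    \<le> (\<Sum>i=1..N. \<Sum>j=1..N. 4 * ((a i (\<pi> i))\<^sup>2 + (a j (\<pi> j))\<^sup>2 + (a i (\<pi> j))\<^sup>2 + (a j (\<pi> i))\<^sup>2))"
    unfolding transposition_drop_def by (intro sum_mono sq)
  also have "\<dots> = 4 * (real N * Y \<pi> + real N * Y \<pi>
      + (\<Sum>i=1..N. \<Sum>j=1..N. (a i (\<pi> j))\<^sup>2) + (\<Sum>i=1..N. \<Sum>j=1..N. (a j (\<pi> i))\<^sup>2))"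
    unfolding sum_distrib_left[symmetric] sum.distrib
    by (simp add: perm_sum_def flip: sum_distrib_left)
  also have "\<dots> = 8 * (real N * Y \<pi> + real N * perm_exp N Y)"
    unfolding Q1 Q2 by simp
  finally show ?thesis .
qed

text \<open>
  The general bound for nonnegative matrices, applied to the squares of the entries, combined with
  \<open>E Y \<le> V\<close> and \<open>N / 2 \<le> N - 1\<close>.
\<close>

lemma variance_Y_le:
  "measure_pmf.variance (random_permutation N) Y \<le> 2 * C\<^sup>2 * V + 2 * V\<^sup>2 / N"
proof -
  let ?V = "measure_pmf.variance (random_permutation N) Y" and ?m = "perm_exp N Y"
  have N: "real N / 2 \<le> real N - 1"
    using size by simp
  have "?V \<ge> 0"
    by (rule measure_pmf.variance_positive)
  then have "real N / 2 * ?V \<le> (real N - 1) * ?V"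
    using N by (rule mult_right_mono[rotated])
  also have "\<dots> \<le> real N * C\<^sup>2 * ?m + ?m\<^sup>2"
  proof (rule variance_perm_sum_nonneg_le)
    show "(a i j)\<^sup>2 \<le> C\<^sup>2" if "i \<in> {1..N}" "j \<in> {1..N}" for i j
      using entry_bound[OF that] by (rule power2_le_iff_abs_le[THEN iffD2, OF C_nonneg])
  qed simp
  also have "\<dots> \<le> real N * C\<^sup>2 * V + V\<^sup>2"
    using perm_exp_Y_le perm_exp_Y_nonneg by (intro add_mono mult_left_mono power_mono) auto
  finally have "?V \<le> 2 / real N * (real N * C\<^sup>2 * V + V\<^sup>2)"
    using size by (simp add: field_simps)
  also have "\<dots> = 2 * C\<^sup>2 * V + 2 * V\<^sup>2 / N"
    using size by (simp add: field_simps)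
  finally show ?thesis .
qed

text \<open>
  \<open>D\<close> concentrates at \<open>V\<close>: the fluctuation of \<open>Y\<close> is bounded through its variance, while
  \<open>W\<^sup>2 / N\<close> is nonnegative with expectation only \<open>V / N\<close>.
\<close>

lemma perm_exp_abs_D_le:
  "perm_exp N (\<lambda>\<pi>. \<bar>D \<pi> - V\<bar>) \<le> sqrt (2 * C\<^sup>2 * V + 2 * V\<^sup>2 / N) + 2 * V / N"
proof -
  let ?m = "perm_exp N Y"
  have "perm_exp N (\<lambda>\<pi>. \<bar>D \<pi> - V\<bar>) \<le> perm_exp N (\<lambda>\<pi>. \<bar>Y \<pi> - ?m\<bar> + ((W \<pi>)\<^sup>2 / N + V / N))"
  proof (rule perm_exp_mono)
    fix \<pi>
    have "D \<pi> - V = (Y \<pi> - ?m) + (W \<pi>)\<^sup>2 / N - V / N"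
      by (simp add: D_def perm_exp_Y)
    moreover have "0 \<le> (W \<pi>)\<^sup>2 / N" "0 \<le> V / N"
      using V_nonneg by simp_all
    ultimately show "\<bar>D \<pi> - V\<bar> \<le> \<bar>Y \<pi> - ?m\<bar> + ((W \<pi>)\<^sup>2 / N + V / N)"
      by linarith
  qed
  also have "\<dots> = perm_exp N (\<lambda>\<pi>. \<bar>Y \<pi> - ?m\<bar>) + 2 * V / N"
    by (simp add: V_def)
  also have "perm_exp N (\<lambda>\<pi>. \<bar>Y \<pi> - ?m\<bar>) \<le> sqrt (2 * C\<^sup>2 * V + 2 * V\<^sup>2 / N)"
    using perm_exp_abs_le_sqrt variance_Y_le by (rule order_trans[OF _ real_sqrt_le_mono])
  finally show ?thesis
    by simp
qed

text \<open>
  Stein's equation for the test function \<open>iexp (s * W)\<close>. In the covariance formula, the first-order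
  part of the increment under the transposition of \<open>i\<close> and \<open>j\<close> is
  \<open>\<i> s * transposition_drop a \<pi> i j * iexp (s * W \<pi>)\<close>; these parts add up to the term with \<open>D\<close>. The
  second-order remainders are bounded by \<open>C s\<^sup>2 / 2\<close> times the sum of the squared drops, and the
  expectation of that sum is at most \<open>16 N V\<close>.
\<close>

lemma stein_iexp:
  "cmod (perm_exp N (\<lambda>\<pi>. W \<pi> *\<^sub>R iexp (s * W \<pi>))
     - (\<i> * of_real s) * perm_exp N (\<lambda>\<pi>. D \<pi> *\<^sub>R iexp (s * W \<pi>))) \<le> 8 * C * V * s\<^sup>2"
proof -
  let ?e = "\<lambda>\<pi>. iexp (s * W \<pi>)"
  let ?T = "\<lambda>\<pi>. \<Sum>i=1..N. \<Sum>j=1..N. a i (\<pi> i) *\<^sub>R (?e \<pi> - ?e (\<pi> \<circ> Transposition.transpose i j))"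
  let ?L = "perm_exp N (\<lambda>\<pi>. W \<pi> *\<^sub>R ?e \<pi>) - (\<i> * of_real s) * perm_exp N (\<lambda>\<pi>. D \<pi> *\<^sub>R ?e \<pi>)"
  have pointwise: "cmod (?T \<pi> - real N *\<^sub>R ((\<i> * of_real s) * (D \<pi> *\<^sub>R ?e \<pi>)))
      \<le> 4 * C * s\<^sup>2 * (real N * Y \<pi> + real N * perm_exp N Y)" if \<pi>: "\<pi> permutes {1..N}" for \<pi>
  proof -
    let ?d = "transposition_drop a \<pi>"
    have "real N *\<^sub>R ((\<i> * of_real s) * (D \<pi> *\<^sub>R ?e \<pi>))
        = (real N * D \<pi>) *\<^sub>R ((\<i> * of_real s) * ?e \<pi>)"
      by (simp add: scaleR_conv_of_real)
    also have "\<dots> = (\<Sum>i=1..N. \<Sum>j=1..N. a i (\<pi> i) *\<^sub>R ((\<i> * of_real (s * ?d i j)) * ?e \<pi>))"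
      unfolding weighted_transposition_drop_sum[OF \<pi>, symmetric] scaleR_sum_left
      by (intro sum.cong refl) (simp add: scaleR_conv_of_real)
    finally have T: "?T \<pi> - real N *\<^sub>R ((\<i> * of_real s) * (D \<pi> *\<^sub>R ?e \<pi>))
        = (\<Sum>i=1..N. \<Sum>j=1..N. a i (\<pi> i) *\<^sub>R
            (?e \<pi> - ?e (\<pi> \<circ> Transposition.transpose i j) - (\<i> * of_real (s * ?d i j)) * ?e \<pi>))"
      by (simp only: sum_subtractf scaleR_diff_right)
    have "cmod (?T \<pi> - real N *\<^sub>R ((\<i> * of_real s) * (D \<pi> *\<^sub>R ?e \<pi>)))
        \<le> (\<Sum>i=1..N. \<Sum>j=1..N. C * ((s * ?d i j)\<^sup>2 / 2))"
      unfolding T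
    proof (intro sum_norm_le)
      fix i j assume ij: "i \<in> {1..N}" "j \<in> {1..N}"
      have "\<bar>a i (\<pi> i)\<bar> \<le> C"
        using ij(1) \<pi> by (intro entry_bound) (simp_all only: permutes_in_image)
      moreover have "cmod (?e \<pi> - ?e (\<pi> \<circ> Transposition.transpose i j) - (\<i> * of_real (s * ?d i j)) * ?e \<pi>)
          \<le> (s * ?d i j)\<^sup>2 / 2"
        using iexp_diff_bound[of "s * W \<pi>" "s * ?d i j"]
        unfolding perm_sum_transpose[OF ij] right_diff_distrib .
      ultimately show "cmod (a i (\<pi> i) *\<^sub>R
          (?e \<pi> - ?e (\<pi> \<circ> Transposition.transpose i j) - (\<i> * of_real (s * ?d i j)) * ?e \<pi>))
          \<le> C * ((s * ?d i j)\<^sup>2 / 2)"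
        unfolding norm_scaleR by (intro mult_mono C_nonneg norm_ge_zero)
    qed
    also have "\<dots> = C * s\<^sup>2 / 2 * (\<Sum>i=1..N. \<Sum>j=1..N. (?d i j)\<^sup>2)"
    proof -
      have "C * ((s * x)\<^sup>2 / 2) = C * s\<^sup>2 / 2 * x\<^sup>2" for x
        by (simp add: power_mult_distrib)
      then show ?thesis
        by (simp only: sum_distrib_left)
    qed
    also have "\<dots> \<le> C * s\<^sup>2 / 2 * (8 * (real N * Y \<pi> + real N * perm_exp N Y))"
      using C_nonneg by (intro mult_left_mono transposition_drop_sq_sum_le[OF \<pi>]) simp
    also have "\<dots> = 4 * C * s\<^sup>2 * (real N * Y \<pi> + real N * perm_exp N Y)"
      by simp
    finally show ?thesis .
  qed
  have L: "real N *\<^sub>R ?L = perm_exp N (\<lambda>\<pi>. ?T \<pi> - real N *\<^sub>R ((\<i> * of_real s) * (D \<pi> *\<^sub>R ?e \<pi>)))"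
  proof -
    have "real N *\<^sub>R perm_exp N (\<lambda>\<pi>. W \<pi> *\<^sub>R ?e \<pi>) = perm_exp N ?T"
      unfolding perm_sum_exchange perm_exp_W by simp
    moreover have "real N *\<^sub>R ((\<i> * of_real s) * perm_exp N (\<lambda>\<pi>. D \<pi> *\<^sub>R ?e \<pi>))
        = perm_exp N (\<lambda>\<pi>. real N *\<^sub>R ((\<i> * of_real s) * (D \<pi> *\<^sub>R ?e \<pi>)))"
      by (simp only: integral_scaleR_right integral_mult_right_zero)
    ultimately show ?thesis
      by (simp only: scaleR_diff_right Bochner_Integration.integral_diff integrable_random_permutation)
  qed
  have "real N * cmod ?L = cmod (real N *\<^sub>R ?L)"
    by (simp only: norm_scaleR abs_of_nat)
  also have "\<dots> = cmod (perm_exp N (\<lambda>\<pi>. ?T \<pi> - real N *\<^sub>R ((\<i> * of_real s) * (D \<pi> *\<^sub>R ?e \<pi>))))"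
    by (simp only: L)
  also have "\<dots> \<le> perm_exp N (\<lambda>\<pi>. cmod (?T \<pi> - real N *\<^sub>R ((\<i> * of_real s) * (D \<pi> *\<^sub>R ?e \<pi>))))"
    by (rule integral_norm_bound)
  also have "\<dots> \<le> perm_exp N (\<lambda>\<pi>. 4 * C * s\<^sup>2 * (real N * Y \<pi> + real N * perm_exp N Y))"
    by (intro perm_exp_mono pointwise)
  also have "\<dots> = real N * (8 * C * s\<^sup>2 * perm_exp N Y)"
    by simp
  also have "\<dots> \<le> real N * (8 * C * s\<^sup>2 * V)"
    using C_nonneg by (intro mult_left_mono perm_exp_Y_le) simp_all
  finally show ?thesis
    using size by (simp add: mult_ac)
qed

text \<open>
  Replacing \<open>D\<close> by its expectation \<open>V\<close> in Stein's equation yields the Gaussian differential equation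
  for the characteristic function of \<open>W\<close>, with error coefficients from \<open>perm_exp_abs_D_le\<close> (linear in
  \<open>s\<close>) and \<open>stein_iexp\<close> (quadratic in \<open>s\<close>).
\<close>

lemma perm_exp_iexp_gaussian_bound:
  "cmod (perm_exp N (\<lambda>\<pi>. iexp (s * W \<pi>)) - of_real (exp (- (V * s\<^sup>2) / 2)))
    \<le> (sqrt (2 * C\<^sup>2 * V + 2 * V\<^sup>2 / N) + 2 * V / N) * s\<^sup>2 + 8 * C * V * \<bar>s\<bar> ^ 3"
proof (rule gaussian_ode_bound[OF perm_exp_iexp_has_vector_derivative])
  let ?\<alpha> = "sqrt (2 * C\<^sup>2 * V + 2 * V\<^sup>2 / N) + 2 * V / N"
  fix s :: real
  let ?e = "\<lambda>\<pi>. iexp (s * W \<pi>)"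
  have diff: "perm_exp N (\<lambda>\<pi>. (D \<pi> - V) *\<^sub>R ?e \<pi>) = perm_exp N (\<lambda>\<pi>. D \<pi> *\<^sub>R ?e \<pi>) - V *\<^sub>R perm_exp N ?e"
    by (simp only: scaleR_diff_left Bochner_Integration.integral_diff integrable_random_permutation
        integral_scaleR_right)
  let ?A = "\<i> * (perm_exp N (\<lambda>\<pi>. W \<pi> *\<^sub>R ?e \<pi>)
    - (\<i> * of_real s) * perm_exp N (\<lambda>\<pi>. D \<pi> *\<^sub>R ?e \<pi>))"
  let ?B = "of_real s * perm_exp N (\<lambda>\<pi>. (D \<pi> - V) *\<^sub>R ?e \<pi>)"
  have split: "perm_exp N (\<lambda>\<pi>. \<i> * (W \<pi> *\<^sub>R ?e \<pi>)) + of_real (V * s) * perm_exp N ?e = ?A - ?B"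
    unfolding integral_mult_right_zero diff by (simp add: scaleR_conv_of_real algebra_simps)
  have A: "cmod ?A \<le> 8 * C * V * s\<^sup>2"
    unfolding norm_mult[of \<i>] using stein_iexp[of s] by (simp only: norm_ii mult_1)
  have "cmod (perm_exp N (\<lambda>\<pi>. (D \<pi> - V) *\<^sub>R ?e \<pi>)) \<le> perm_exp N (\<lambda>\<pi>. cmod ((D \<pi> - V) *\<^sub>R ?e \<pi>))"
    by (rule integral_norm_bound)
  then have "cmod (perm_exp N (\<lambda>\<pi>. (D \<pi> - V) *\<^sub>R ?e \<pi>)) \<le> perm_exp N (\<lambda>\<pi>. \<bar>D \<pi> - V\<bar>)"
    by simp
  then have "cmod (perm_exp N (\<lambda>\<pi>. (D \<pi> - V) *\<^sub>R ?e \<pi>)) \<le> ?\<alpha>"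
    using perm_exp_abs_D_le by (rule order_trans)
  then have B: "cmod ?B \<le> \<bar>s\<bar> * ?\<alpha>"
    unfolding norm_mult norm_of_real by (rule mult_left_mono) simp
  show "cmod (perm_exp N (\<lambda>\<pi>. \<i> * (W \<pi> *\<^sub>R ?e \<pi>)) + of_real (V * s) * perm_exp N ?e)
      \<le> ?\<alpha> * \<bar>s\<bar> + 8 * C * V * s\<^sup>2"
    unfolding split using norm_triangle_ineq4[of ?A ?B] A B by (simp only: mult.commute[of "\<bar>s\<bar>"])
qed (use V_nonneg C_nonneg in simp_all)

text \<open>
  The previous bound at \<open>s = t / sqrt V\<close>. Every error term now tends to zero as \<open>V\<close> and \<open>N\<close> grow.
\<close>

lemma standardized_iexp_bound:
  assumes "V > 0"
  shows "cmod (perm_exp N (\<lambda>\<pi>. iexp (t * (W \<pi> / sqrt V))) - of_real (exp (- (t\<^sup>2) / 2)))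
    \<le> (sqrt (2 * C\<^sup>2 / V + 2 / N) + 2 / N) * t\<^sup>2 + 8 * C * \<bar>t\<bar> ^ 3 / sqrt V"
proof -
  have "sqrt (2 * C\<^sup>2 * V + 2 * V\<^sup>2 / N) = sqrt (V\<^sup>2 * (2 * C\<^sup>2 / V + 2 / N))"
    using assms by (simp add: field_simps power2_eq_square)
  then have 1: "sqrt (2 * C\<^sup>2 * V + 2 * V\<^sup>2 / N) = V * sqrt (2 * C\<^sup>2 / V + 2 / N)"
    using assms by (simp add: real_sqrt_mult)
  have 2: "V * (t / sqrt V)\<^sup>2 = t\<^sup>2" "V * \<bar>t / sqrt V\<bar> ^ 3 = \<bar>t\<bar> ^ 3 / sqrt V"
    using assms by (simp_all add: power_divide power3_eq_cube field_simps)
  have "(V * sqrt (2 * C\<^sup>2 / V + 2 / N) + 2 * V / N) * (t / sqrt V)\<^sup>2 + 8 * C * V * \<bar>t / sqrt V\<bar> ^ 3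
      = (sqrt (2 * C\<^sup>2 / V + 2 / N) + 2 / N) * (V * (t / sqrt V)\<^sup>2) + 8 * C * (V * \<bar>t / sqrt V\<bar> ^ 3)"
    by (simp add: algebra_simps)
  also have "\<dots> = (sqrt (2 * C\<^sup>2 / V + 2 / N) + 2 / N) * t\<^sup>2 + 8 * C * \<bar>t\<bar> ^ 3 / sqrt V"
    unfolding 2 by simp
  finally have rhs: "(V * sqrt (2 * C\<^sup>2 / V + 2 / N) + 2 * V / N) * (t / sqrt V)\<^sup>2 + 8 * C * V * \<bar>t / sqrt V\<bar> ^ 3
      = (sqrt (2 * C\<^sup>2 / V + 2 / N) + 2 / N) * t\<^sup>2 + 8 * C * \<bar>t\<bar> ^ 3 / sqrt V" .
  have "t / sqrt V * x = t * (x / sqrt V)" for x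
    by simp
  then show ?thesis
    using perm_exp_iexp_gaussian_bound[of "t / sqrt V"] unfolding 1 rhs by (simp only: 2)
qed

end

section \<open>Centring and passage to the limit\<close>

definition double_centre :: "nat \<Rightarrow> (nat \<Rightarrow> nat \<Rightarrow> real) \<Rightarrow> nat \<Rightarrow> nat \<Rightarrow> real" where
  "double_centre N A i j = A i j - (\<Sum>k=1..N. A i k) / N - (\<Sum>k=1..N. A k j) / N
     + (\<Sum>k=1..N. \<Sum>l=1..N. A k l) / (real N)\<^sup>2"

lemma centred_matrix_double_centre:
  assumes A: "\<And>i j. i \<in> {1..N} \<Longrightarrow> j \<in> {1..N} \<Longrightarrow> \<bar>A i j\<bar> \<le> K" and N: "N \<ge> 2"
  shows "centred_matrix N (double_centre N A) (4 * K)"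
proof
  let ?T = "\<Sum>k=1..N. \<Sum>l=1..N. A k l"
  have T: "(\<Sum>l=1..N. \<Sum>k=1..N. A k l) = ?T"
    by (rule sum.swap)
  have T2: "real N * (?T / (real N)\<^sup>2) = ?T / N"
    using N by (simp add: power2_eq_square)
  show "(\<Sum>j=1..N. double_centre N A i j) = 0" for i
  proof -
    have "(\<Sum>j=1..N. double_centre N A i j)
        = (\<Sum>j=1..N. A i j) - real N * ((\<Sum>k=1..N. A i k) / N)
          - (\<Sum>j=1..N. \<Sum>k=1..N. A k j) / N + real N * (?T / (real N)\<^sup>2)"
      by (simp add: double_centre_def sum.distrib sum_subtractf flip: sum_divide_distrib)
    then show ?thesis
      unfolding T T2 using N by simp
  qed
  show "(\<Sum>i=1..N. double_centre N A i j) = 0" for j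
  proof -
    have "(\<Sum>i=1..N. double_centre N A i j)
        = (\<Sum>i=1..N. A i j) - ?T / N - real N * ((\<Sum>k=1..N. A k j) / N) + real N * (?T / (real N)\<^sup>2)"
      by (simp add: double_centre_def sum.distrib sum_subtractf flip: sum_divide_distrib)
    then show ?thesis
      unfolding T2 using N by simp
  qed
  have mean: "\<bar>(\<Sum>k=1..N. f k) / N\<bar> \<le> K" if f: "\<And>k. k \<in> {1..N} \<Longrightarrow> \<bar>f k\<bar> \<le> K" for f :: "nat \<Rightarrow> real"
  proof -
    have "\<bar>\<Sum>k=1..N. f k\<bar> \<le> (\<Sum>k=1..N. \<bar>f k\<bar>)"
      by (rule sum_abs)
    also have "\<dots> \<le> (\<Sum>k=1..N. K)"
      by (intro sum_mono f)
    finally show ?thesis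
      using N by (simp add: field_simps)
  qed
  fix i j assume ij: "i \<in> {1..N}" "j \<in> {1..N}"
  have "?T / (real N)\<^sup>2 = (\<Sum>k=1..N. (\<Sum>l=1..N. A k l) / N) / N"
    by (simp add: power2_eq_square flip: sum_divide_distrib)
  also have "\<bar>\<dots>\<bar> \<le> K"
    by (intro mean A)
  finally have "\<bar>?T / (real N)\<^sup>2\<bar> \<le> K" .
  moreover have "\<bar>(\<Sum>k=1..N. A i k) / N\<bar> \<le> K" "\<bar>(\<Sum>k=1..N. A k j) / N\<bar> \<le> K" "\<bar>A i j\<bar> \<le> K"
    by (intro mean A ij; assumption)+
  ultimately show "\<bar>double_centre N A i j\<bar> \<le> 4 * K"
    unfolding double_centre_def by linarith
qed (rule N)

text \<open>
  A permutation visits every row and every column exactly once, so the subtracted row and column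
  means contribute the same constant for each permutation.
\<close>

lemma perm_sum_double_centre:
  assumes \<pi>: "\<pi> permutes {1..N}" and N: "N \<ge> 1"
  shows "perm_sum (double_centre N A) N \<pi> = perm_sum A N \<pi> - perm_exp N (perm_sum A N)"
proof -
  let ?T = "\<Sum>k=1..N. \<Sum>l=1..N. A k l"
  have "(\<Sum>i=1..N. \<Sum>k=1..N. A k (\<pi> i)) = (\<Sum>i=1..N. \<Sum>k=1..N. A k i)"
    using sum.permute[OF \<pi>, of "\<lambda>j. \<Sum>k=1..N. A k j"] by (simp add: o_def)
  also have "\<dots> = ?T"
    by (rule sum.swap)
  finally have T: "(\<Sum>i=1..N. \<Sum>k=1..N. A k (\<pi> i)) = ?T" .
  have "perm_sum (double_centre N A) N \<pi>
      = perm_sum A N \<pi> - ?T / N - (\<Sum>i=1..N. \<Sum>k=1..N. A k (\<pi> i)) / N + real N * (?T / (real N)\<^sup>2)"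
    by (simp add: perm_sum_def double_centre_def sum.distrib sum_subtractf flip: sum_divide_distrib)
  also have "\<dots> = perm_sum A N \<pi> - ?T / N"
    unfolding T using N by (simp add: power2_eq_square)
  also have "?T / N = perm_exp N (perm_sum A N)"
    unfolding perm_exp_perm_sum[symmetric] using N by simp
  finally show ?thesis .
qed

lemma standardized_perm_sum_iexp_bound:
  fixes A :: "nat \<Rightarrow> nat \<Rightarrow> real" and N :: nat and K t :: real
  defines "m \<equiv> perm_exp N (perm_sum A N)"
    and "v \<equiv> measure_pmf.variance (random_permutation N) (perm_sum A N)"
  assumes A: "\<And>i j. i \<in> {1..N} \<Longrightarrow> j \<in> {1..N} \<Longrightarrow> \<bar>A i j\<bar> \<le> K" and N: "N \<ge> 2" and v: "v > 0"
  shows "cmod (perm_exp N (\<lambda>\<pi>. iexp (t * ((perm_sum A N \<pi> - m) / sqrt v)))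
      - of_real (exp (- (t\<^sup>2) / 2)))
    \<le> (sqrt (2 * (4 * K)\<^sup>2 / v + 2 / N) + 2 / N) * t\<^sup>2 + 8 * (4 * K) * \<bar>t\<bar> ^ 3 / sqrt v"
proof -
  interpret centred_matrix N "double_centre N A" "4 * K"
    using A N by (rule centred_matrix_double_centre)
  have W: "W \<pi> = perm_sum A N \<pi> - m" if "\<pi> permutes {1..N}" for \<pi>
    unfolding m_def using that N by (intro perm_sum_double_centre) auto
  have V: "V = v"
    unfolding V_def v_def m_def[symmetric] by (intro perm_exp_cong) (simp only: W)
  have "perm_exp N (\<lambda>\<pi>. iexp (t * (W \<pi> / sqrt v))) = perm_exp N (\<lambda>\<pi>. iexp (t * ((perm_sum A N \<pi> - m) / sqrt v)))"
    by (intro perm_exp_cong) (simp only: W)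
  then show ?thesis
    using standardized_iexp_bound[of t] v unfolding V by simp
qed

text \<open>
  The bound on characteristic functions together with Levy's continuity theorem. The bound holds
  only for \<open>N \<ge> 2\<close> and positive variance, both of which hold for all large \<open>N\<close>.
\<close>

theorem combinatorial_central_limit:
  fixes A :: "nat \<Rightarrow> nat \<Rightarrow> nat \<Rightarrow> real" and K :: real
  defines "m \<equiv> \<lambda>N. perm_exp N (perm_sum (A N) N)"
    and "v \<equiv> \<lambda>N. measure_pmf.variance (random_permutation N) (perm_sum (A N) N)"
  assumes A: "\<And>N i j. i \<in> {1..N} \<Longrightarrow> j \<in> {1..N} \<Longrightarrow> \<bar>A N i j\<bar> \<le> K"
    and v: "filterlim v at_top sequentially"
  shows "weak_conv_m
    (\<lambda>N. distr (measure_pmf (random_permutation N)) borel (\<lambda>\<pi>. (perm_sum (A N) N \<pi> - m N) / sqrt (v N)))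
    std_normal_distribution"
proof (rule levy_continuity)
  show "real_distribution std_normal_distribution"
    by (rule real_dist_normal_dist)
  show "real_distribution (distr (measure_pmf (random_permutation N)) borel
      (\<lambda>\<pi>. (perm_sum (A N) N \<pi> - m N) / sqrt (v N)))" for N
    by (rule prob_space.real_distribution_distr[OF measure_pmf.prob_space_axioms]) simp
  fix t :: real
  let ?\<phi> = "\<lambda>N. perm_exp N (\<lambda>\<pi>. iexp (t * ((perm_sum (A N) N \<pi> - m N) / sqrt (v N))))"
  let ?g = "complex_of_real (exp (- (t\<^sup>2) / 2))"
  let ?\<epsilon> = "\<lambda>N. (sqrt (2 * (4 * K)\<^sup>2 / v N + 2 / real N) + 2 / real N) * t\<^sup>2 + 8 * (4 * K) * \<bar>t\<bar> ^ 3 / sqrt (v N)"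
  have "eventually (\<lambda>N. v N > 0) sequentially"
    using v unfolding filterlim_at_top_dense by blast
  with eventually_ge_at_top[of 2]
  have "eventually (\<lambda>N. cmod (?\<phi> N - ?g) \<le> ?\<epsilon> N) sequentially"
  proof eventually_elim
    case (elim N)
    then show ?case
      unfolding m_def v_def by (intro standardized_perm_sum_iexp_bound A)
  qed
  moreover have "?\<epsilon> \<longlonglongrightarrow> 0"
  proof -
    have sv: "filterlim (\<lambda>N. sqrt (v N)) at_top sequentially"
      using sqrt_at_top v by (rule filterlim_compose)
    have "?\<epsilon> \<longlonglongrightarrow> (sqrt (0 + 0) + 0) * t\<^sup>2 + 0"
      by (intro tendsto_intros tendsto_divide_0[OF tendsto_const] filterlim_at_top_imp_at_infinity
          filterlim_real_sequentially v sv)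
    then show ?thesis by simp
  qed
  ultimately have "(\<lambda>N. ?\<phi> N - ?g) \<longlonglongrightarrow> 0"
    by (rule Lim_null_comparison)
  then have "?\<phi> \<longlonglongrightarrow> ?g"
    by (rule LIM_zero_cancel)
  moreover have "char (distr (measure_pmf (random_permutation N)) borel
      (\<lambda>\<pi>. (perm_sum (A N) N \<pi> - m N) / sqrt (v N))) t = ?\<phi> N" for N
    unfolding char_def by (rule integral_distr) simp_all
  ultimately show "(\<lambda>N. char (distr (measure_pmf (random_permutation N)) borel
      (\<lambda>\<pi>. (perm_sum (A N) N \<pi> - m N) / sqrt (v N))) t) \<longlonglongrightarrow> char std_normal_distribution t"
    by (simp only: char_std_normal_distribution)
qed

theorem theorem3p8:
  fixes G :: "nat \<Rightarrow> nat pair_pre_digraph"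
    and S :: "nat \<Rightarrow> (nat \<Rightarrow> nat) \<Rightarrow> real"
  defines "S \<equiv> \<lambda>N. perm_sum (adjacency_matrix (G N)) N"
  assumes graph: "\<And>N. pair_graph (G N)"
    and vertices: "\<And>N. pverts (G N) = {1..N}"
    and variance: "filterlim (\<lambda>N. measure_pmf.variance (random_permutation N) (S N))
                     at_top sequentially"
  shows "weak_conv_m
           (\<lambda>N. distr (measure_pmf (random_permutation N)) borel
              (\<lambda>\<pi>. (S N \<pi> - measure_pmf.expectation (random_permutation N) (S N))
                     / sqrt (measure_pmf.variance (random_permutation N) (S N))))
           std_normal_distribution"
  unfolding S_def
proof (rule combinatorial_central_limit)
  show "\<bar>adjacency_matrix (G N) i j\<bar> \<le> 1" for N i j
    by (simp add: adjacency_matrix_def)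
qed (use variance in \<open>simp only: S_def\<close>)

end
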